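(* Let $k$ be a field of characteristic $p>0$, let $m\ge 1$, let $(\ell,r_1,r_2)\in\Omega_m$, and let $A(T)=\eta(a_1,\dots,a_m,a_{m+1},\dots,a_{2m},a_{2m+1})\in{}^{\ell}\mathfrak{H}^{r_1}_{r_2}$. Then $A(T)$ is an exponential matrix if and only if the following conditions (1), (2), (3) hold: (1) The polynomials $a_i$ $(1\le i\le 2m)$ are $p$-polynomials. (2) There exists a unique regular symmetric matrix $S=(s_{i,j})_{1\le i,j\le r_1}\in GL(r_1,k)$ such that $(a_{m+1},\dots,a_{m+r_1})=(a_1,\dots,a_{r_1})\,S$, and furthermore if $p=2$, the diagonal entries $s_{i,i}$ $(1\le i\le r_1)$ of $S$ are zero. (3) There exists a unique $p$-polynomial $\alpha(T)\in k[T]$ such that $$a_{2m+1}(T)=\begin{cases}\alpha(T)+\sum_{1\le i<j\le r_1}s_{i,j}\,a_i(T)\,a_j(T) & \text{if } p=2,\\ \alpha(T)+\tfrac12\,\boldsymbol{a}(T)\,S\;{}^t\boldsymbol{a}(T) & \text{if } p\ge 3,\end{cases}$$ where $\boldsymbol{a}(T):=(a_1(T),\dots,a_{r_1}(T))\in k[T]^{r_1}$.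
   Context: $k[T]$ is the polynomial ring in one variable over $k$. A matrix $A(T)\in\mathrm{Mat}(n,k[T])$ is exponential if $A(0)=I_n$ and $A(T)A(T')=A(T+T')$, where $T,T'$ are indeterminates over $k$. A $p$-polynomial is a polynomial of the form $\sum_{i\ge 0}c_iT^{p^i}$ with $c_i\in k$ (finite sum). For $a_1,\dots,a_{2m+1}\in k[T]$, $\eta(a_1,\dots,a_{2m+1})\in\mathrm{Mat}(m+2,k[T])$ is the upper triangular matrix with all diagonal entries $1$, first row $(1,a_1,\dots,a_m,a_{2m+1})$, last column ${}^t(a_{2m+1},a_{m+1},\dots,a_{2m},1)$, and all other off-diagonal entries $0$. $\Omega_m:=\{(\ell,r_1,r_2)\in\mathbb{Z}^3\mid 1\le \ell\le m,\ 1\le r_1\le \ell,\ 0\le r_2\le m-\ell\}$. For $(\ell,r_1,r_2)\in\Omega_m$, ${}^{\ell}\mathfrak{H}^{r_1}_{r_2}$ is the set of all $\eta(a_1,\dots,a_{2m+1})$ such that: (i) $a_1,\dots,a_\ell$ are linearly independent over $k$; (ii) $a_{m+1},\dots,a_{m+r_1},a_{m+\ell+1},\dots,a_{m+\ell+r_2}$ are linearly independent over $k$; (iii) $a_i=0$ for all $i$ with $\ell+1\le i\le m$, or $m+r_1+1\le i\le m+\ell$, or $m+\ell+r_2+1\le i\le 2m$. *)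

theory Defs
  imports "Jordan_Normal_Form.Matrix" "HOL-Computational_Algebra.Computational_Algebra"
begin

text \<open>
  The polynomial ring $k[T]$ is \<^typ>\<open>'a poly\<close>, and $k[T,T']$ is \<^typ>\<open>'a poly poly\<close> with
  $T$ the inner and $T'$ the outer variable. Matrices are 0-indexed, whereas families of
  polynomials $a_1, a_2, \dots$ are functions \<^typ>\<open>nat \<Rightarrow> 'a poly\<close> indexed from 1.
\<close>

definition var_T :: "'a::field poly poly" where
  "var_T = [:[:0, 1:]:]"

definition var_T' :: "'a::field poly poly" where
  "var_T' = [:0, 1:]"

definition subst2 :: "'a::field poly poly \<Rightarrow> 'a poly \<Rightarrow> 'a poly poly" where
  "subst2 x f = poly (map_poly (\<lambda>c. [:[:c:]:]) f) x"

definition exponential_matrix :: "nat \<Rightarrow> 'a::field poly mat \<Rightarrow> bool" where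
  "exponential_matrix n A \<longleftrightarrow>
     A \<in> carrier_mat n n \<and>
     map_mat (\<lambda>f. poly f 0) A = 1\<^sub>m n \<and>
     map_mat (subst2 var_T) A * map_mat (subst2 var_T') A = map_mat (subst2 (var_T + var_T')) A"

definition p_polynomial :: "nat \<Rightarrow> 'a::field poly \<Rightarrow> bool" where
  "p_polynomial p f \<longleftrightarrow> (\<exists>(c :: nat \<Rightarrow> 'a) N. f = (\<Sum>i<N. monom (c i) (p ^ i)))"

definition eta :: "nat \<Rightarrow> (nat \<Rightarrow> 'a::field poly) \<Rightarrow> 'a poly mat" where
  "eta m a = mat (m + 2) (m + 2) (\<lambda>(i, j).
     if i = j then 1
     else if i = 0 then (if j = m + 1 then a (2 * m + 1) else a j)
     else if j = m + 1 then a (m + i)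
     else 0)"

lemma vector_space_poly: "vector_space (smult :: 'a::field \<Rightarrow> 'a poly \<Rightarrow> 'a poly)"
  by unfold_locales (simp_all add: smult_add_right smult_add_left)

text \<open>
  The library notion of independence concerns sets; for a family the members must in addition be
  pairwise distinct.
\<close>

definition lin_indep_family :: "nat set \<Rightarrow> (nat \<Rightarrow> 'a::field poly) \<Rightarrow> bool" where
  "lin_indep_family I a \<longleftrightarrow> inj_on a I \<and> \<not> Modules.module.dependent smult (a ` I)"

lemma lin_indep_family_iff:
  fixes a :: "nat \<Rightarrow> 'a::field poly"
  assumes fin: "finite I"
  shows "lin_indep_family I a \<longleftrightarrow>
    (\<forall>c. (\<Sum>i\<in>I. smult (c i) (a i)) = 0 \<longrightarrow> (\<forall>i\<in>I. c i = 0))"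
proof -
  interpret P: vector_space "smult :: 'a \<Rightarrow> 'a poly \<Rightarrow> 'a poly"
    by (rule vector_space_poly)
  have dep: "P.dependent (a ` I) \<longleftrightarrow>
      (\<exists>u. (\<exists>v\<in>a ` I. u v \<noteq> 0) \<and> (\<Sum>v\<in>a ` I. smult (u v) v) = 0)"
    using fin by (intro P.dependent_finite) auto
  show ?thesis
  proof
    assume L: "lin_indep_family I a"
    then have inj: "inj_on a I" and ind: "\<not> P.dependent (a ` I)"
      by (auto simp: lin_indep_family_def)
    show "\<forall>c. (\<Sum>i\<in>I. smult (c i) (a i)) = 0 \<longrightarrow> (\<forall>i\<in>I. c i = 0)"
    proof (intro allI impI ballI)
      fix c i
      assume s: "(\<Sum>i\<in>I. smult (c i) (a i)) = 0" and i: "i \<in> I"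
      define u where "u = c \<circ> the_inv_into I a"
      have u: "u (a j) = c j" if "j \<in> I" for j
        using that inj by (simp add: u_def the_inv_into_f_f)
      have "(\<Sum>v\<in>a ` I. smult (u v) v) = 0"
        using s u by (simp add: sum.reindex[OF inj] cong: sum.cong)
      then show "c i = 0"
        using ind dep u i by (metis imageI)
    qed
  next
    assume R: "\<forall>c. (\<Sum>i\<in>I. smult (c i) (a i)) = 0 \<longrightarrow> (\<forall>i\<in>I. c i = 0)"
    have inj: "inj_on a I"
    proof (rule inj_onI, rule ccontr)
      fix i j
      assume ij: "i \<in> I" "j \<in> I" "a i = a j" "i \<noteq> j"
      define c :: "nat \<Rightarrow> 'a" where "c = (\<lambda>l. if l = i then 1 else if l = j then -1 else 0)"
      have "(\<Sum>l\<in>I. smult (c l) (a l)) = (\<Sum>l\<in>{i, j}. smult (c l) (a l))"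
        using fin ij by (intro sum.mono_neutral_right) (auto simp: c_def)
      also have "\<dots> = 0"
        using ij by (simp add: c_def)
      finally show False
        using R ij(1) by (force simp: c_def)
    qed
    have "\<not> P.dependent (a ` I)"
    proof
      assume "P.dependent (a ` I)"
      then obtain u where u: "\<exists>v\<in>a ` I. u v \<noteq> 0" "(\<Sum>v\<in>a ` I. smult (u v) v) = 0"
        using dep by blast
      from u(2) have "(\<Sum>i\<in>I. smult (u (a i)) (a i)) = 0"
        by (simp add: sum.reindex[OF inj])
      then have "\<forall>i\<in>I. u (a i) = 0"
        using R[rule_format, of "\<lambda>i. u (a i)"] by blast
      with u(1) show False by blast
    qed
    with inj show "lin_indep_family I a"
      by (simp add: lin_indep_family_def)
  qed
qed

definition Omega :: "nat \<Rightarrow> (nat \<times> nat \<times> nat) set" where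
  "Omega m = {(l, r1, r2). 1 \<le> l \<and> l \<le> m \<and> 1 \<le> r1 \<and> r1 \<le> l \<and> r2 \<le> m - l}"

definition frakH :: "nat \<Rightarrow> nat \<Rightarrow> nat \<Rightarrow> nat \<Rightarrow> 'a::field poly mat set" where
  "frakH m l r1 r2 = {eta m a | a.
     lin_indep_family {1..l} a \<and>
     lin_indep_family ({m + 1..m + r1} \<union> {m + l + 1..m + l + r2}) a \<and>
     (\<forall>i \<in> {l + 1..m} \<union> {m + r1 + 1..m + l} \<union> {m + l + r2 + 1..2 * m}. a i = 0)}"

definition general_linear :: "nat \<Rightarrow> 'a::field mat set" where
  "general_linear n = {S \<in> carrier_mat n n. invertible_mat S}"

definition symmetric_mat :: "'a mat \<Rightarrow> bool" where
  "symmetric_mat S \<longleftrightarrow> transpose_mat S = S"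

definition const_mat :: "'a::field mat \<Rightarrow> 'a poly mat" where
  "const_mat S = map_mat (\<lambda>c. [:c:]) S"

text \<open>The row vector $(a_{s+1}, \dots, a_{s+r})$ as a $1 \times r$ matrix.\<close>

definition row_slice :: "nat \<Rightarrow> nat \<Rightarrow> (nat \<Rightarrow> 'a::field poly) \<Rightarrow> 'a poly mat" where
  "row_slice s r a = mat 1 r (\<lambda>(_, j). a (s + (j + 1)))"

definition connecting_matrix ::
    "nat \<Rightarrow> nat \<Rightarrow> (nat \<Rightarrow> 'a::field poly) \<Rightarrow> 'a mat \<Rightarrow> bool" where
  "connecting_matrix m r a S \<longleftrightarrow>
     S \<in> general_linear r \<and> symmetric_mat S \<and>
     row_slice m r a = row_slice 0 r a * const_mat S"

text \<open>
  The term added to $\alpha$ in the formula for $a_{2m+1}$; the \<open>1 \<times> 1\<close> matrix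
  $\boldsymbol{a}\,S\,{}^t\boldsymbol{a}$ is identified with its only entry.
\<close>

definition quadratic_part ::
    "nat \<Rightarrow> nat \<Rightarrow> (nat \<Rightarrow> 'a::field poly) \<Rightarrow> 'a mat \<Rightarrow> 'a poly" where
  "quadratic_part p r a S =
     (if p = 2 then
        (\<Sum>(i, j) \<in> {(i, j). 1 \<le> i \<and> i < j \<and> j \<le> r}. smult (S $$ (i - 1, j - 1)) (a i * a j))
      else
        smult (1 / 2)
          ((row_slice 0 r a * const_mat S * transpose_mat (row_slice 0 r a)) $$ (0, 0)))"

end

theory Submission
  imports Defs
begin

text \<open>
  The product rule says that $A$ is exponential iff $a_1, \dots, a_{2m}$ are additive and the
  coboundary $f(T + T') - f(T) - f(T')$ of $f = a_{2m+1}$ equals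
  $\sum_{i \le r_1} a_i(T)\, a_{m+i}(T')$. A coboundary is symmetric under $T \leftrightarrow T'$;
  applying functionals dual to the independent $a_i$ to this symmetry expresses the $a_{m+i}$ through
  the $a_i$ by a symmetric matrix $S$, and exchanging the two families inverts $S$. In
  characteristic 2 the coefficients of $T^n T'^n$ in a coboundary carry the even factor
  ${2n \choose n}$, which forces the diagonal of $S$ to vanish. Conversely the quadratic part has
  exactly this coboundary, so $f$ minus it is additive, i.e. a $p$-polynomial.
\<close>

section \<open>Substitution from k[T] to k[T,T'] as a ring homomorphism, and its
  coefficients\<close>

lemma subst2_0 [simp]: "subst2 x 0 = 0"
  by (simp add: subst2_def)

lemma subst2_pCons: "subst2 x (pCons c f) = [:[:c:]:] + x * subst2 x f"
  by (simp add: subst2_def map_poly_pCons)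

lemma subst2_1 [simp]: "subst2 x 1 = 1"
  using subst2_pCons[of x 1 0] by (simp add: one_pCons)

lemma subst2_add: "subst2 x (f + g) = subst2 x f + subst2 x g"
proof (induction f g rule: poly_induct2)
  case (pCons c f d g)
  have *: "[:[:c + d:]:] = [:[:c:]:] + [:[:d:]:]" by simp
  show ?case
    by (simp only: add_pCons[of c f d g] subst2_pCons pCons.IH * ring_distribs ac_simps)
qed simp

lemma subst2_smult: "subst2 x (smult c f) = smult [:c:] (subst2 x f)"
proof (induction f)
  case (pCons d f)
  have *: "[:[:c * d:]:] = smult [:c:] [:[:d:]:]" by simp
  show ?case
    by (simp only: smult_pCons[of c d f] subst2_pCons pCons.IH * smult_add_right mult_smult_right)
qed simp

lemma subst2_mult: "subst2 x (f * g) = subst2 x f * subst2 x g"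
proof (induction f)
  case (pCons c f)
  have "subst2 x (pCons c f * g) = smult [:c:] (subst2 x g) + x * (subst2 x f * subst2 x g)"
    using pCons by (simp add: subst2_add subst2_smult subst2_pCons)
  also have "smult [:c:] (subst2 x g) = [:[:c:]:] * subst2 x g" by simp
  finally show ?case
    unfolding subst2_pCons by (simp only: ring_distribs ac_simps)
qed simp

lemma subst2_sum: "subst2 x (sum f I) = (\<Sum>i\<in>I. subst2 x (f i))"
  by (induction I rule: infinite_finite_induct) (simp_all add: subst2_add)

lemma subst2_monom: "subst2 x (monom c n) = smult [:c:] (x ^ n)"
proof (induction n)
  case 0
  then show ?case by (simp add: subst2_pCons monom_0)
next
  case (Suc n)
  then show ?case by (simp add: monom_Suc subst2_pCons)
qed

lemma subst2_var_T: "subst2 var_T f = [:f:]"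
  by (induction f) (simp_all add: subst2_pCons, simp add: var_T_def)

lemma coeff_subst2_var_T': "coeff (subst2 var_T' f) i = [:coeff f i:]"
proof (induction f arbitrary: i)
  case (pCons c f)
  then show ?case by (cases i) (simp_all add: subst2_pCons, simp_all add: var_T'_def)
qed simp

text \<open>The outer index \<open>i\<close> counts powers of T' and the inner index
  \<open>j\<close> powers of T, so a product of a polynomial in T and one in T' separates.\<close>

lemma coeff_tensor:
  "coeff (coeff (subst2 var_T f * subst2 var_T' g) i) j = coeff f j * coeff g i"
  by (simp add: subst2_var_T coeff_subst2_var_T')

text \<open>The binomial theorem, obtained from Horner's scheme: multiplying by T + T' adds two
  shifted coefficient tables, which is Pascal's rule.\<close>

lemma coeff_subst2_var_T_plus_var_T':
  "coeff (coeff (subst2 (var_T + var_T') f) i) j = of_nat ((i + j) choose i) * coeff f (i + j)"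
proof (induction f arbitrary: i j)
  case (pCons c f)
  \<comment> \<open>Multiplication by T acts inside the coefficients, as
    \<open>smult [:0, 1:]\<close>; multiplication by T' shifts the outer coefficients, as
    \<open>pCons 0\<close>.\<close>
  have "subst2 (var_T + var_T') (pCons c f) =
      [:[:c:]:] + smult [:0, 1:] (subst2 (var_T + var_T') f) + pCons 0 (subst2 (var_T + var_T') f)"
    by (simp add: subst2_pCons) (simp add: var_T_def var_T'_def ring_distribs)
  then show ?case
    by (cases i; cases j) (simp_all add: pCons.IH coeff_pCons algebra_simps)
qed simp

section \<open>The coboundary f(T + T') - f(T) - f(T'), which vanishes exactly when f is
  additive\<close>

definition defect :: "'a::field poly \<Rightarrow> 'a poly poly" where
  "defect f = subst2 (var_T + var_T') f - subst2 var_T f - subst2 var_T' f"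

lemma coeff_defect:
  "coeff (coeff (defect f) i) j = of_nat ((i + j) choose i) * coeff f (i + j)
     - (if i = 0 then coeff f j else 0) - (if j = 0 then coeff f i else 0)"
  by (cases i; cases j)
     (simp_all add: defect_def coeff_subst2_var_T_plus_var_T' subst2_var_T coeff_subst2_var_T')

lemma defect_add: "defect (f + g) = defect f + defect g"
  by (simp add: defect_def subst2_add)

lemma defect_smult: "defect (smult c f) = smult [:c:] (defect f)"
  by (simp add: defect_def subst2_smult smult_diff_right)

lemma defect_sum: "defect (sum f I) = (\<Sum>i\<in>I. defect (f i))"
  by (simp add: defect_def subst2_sum sum_subtractf)

lemma defect_eq_0_iff:
  "defect f = 0 \<longleftrightarrow> subst2 (var_T + var_T') f = subst2 var_T f + subst2 var_T' f"
  by (auto simp: defect_def algebra_simps)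

text \<open>Expanding (f(T) + f(T'))(g(T) + g(T')) and removing the two pure terms leaves the mixed
  ones.\<close>

lemma defect_mult:
  assumes "defect f = 0" "defect g = 0"
  shows "defect (f * g) =
    subst2 var_T f * subst2 var_T' g + subst2 var_T g * subst2 var_T' f"
  using assms unfolding defect_eq_0_iff by (simp add: defect_def subst2_mult algebra_simps)

lemma defect_zero_coeff_0: "defect f = 0 \<Longrightarrow> coeff f 0 = 0"
  using coeff_defect[of f 0 0] by simp

section \<open>Additive polynomials in characteristic p are the p-polynomials\<close>

lemma CHAR_poly: "CHAR('a::comm_semiring_1 poly) = CHAR('a)"
  by (rule CHAR_eqI) (simp_all add: of_nat_poly of_nat_eq_0_iff_char_dvd)

text \<open>A case of Lucas's theorem: with P = p^e, Frobenius gives (1 + X)^(P q) = (1 + X^P)^q,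
  and the coefficients of X^P are compared.\<close>

lemma of_nat_choose_char_power:
  assumes p: "prime CHAR('a::field)"
  shows "(of_nat (CHAR('a) ^ e * q choose CHAR('a) ^ e) :: 'a) = of_nat q"
proof -
  define P where "P = CHAR('a) ^ e"
  have P: "P > 0" using p by (simp add: P_def prime_gt_0_nat)
  have "prime CHAR('a poly)" using p by (simp add: CHAR_poly)
  then have "([:0, 1:] + 1 :: 'a poly) ^ P = [:0, 1:] ^ P + 1 ^ P"
    by (rule freshmans_dream') (simp add: CHAR_poly P_def)
  moreover have "[:0, 1:] + 1 = ([:1, 1:] :: 'a poly)" by (simp add: one_pCons)
  ultimately have *: "([:1, 1:] :: 'a poly) ^ P = 1 + monom 1 P"
    by (simp add: monom_altdef)
  have "coeff (((1 :: 'a poly) + monom 1 P) ^ q) 0 = 1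
      \<and> coeff (((1 :: 'a poly) + monom 1 P) ^ q) P = of_nat q"
    using P by (induction q) (simp_all add: distrib_right coeff_monom_mult)
  then have "coeff (([:1, 1:] :: 'a poly) ^ (P * q)) P = of_nat q"
    by (simp add: power_mult *)
  moreover have "coeff (([:1, 1:] :: 'a poly) ^ (P * q)) P = of_nat (P * q choose P)" if "q > 0"
    using that by (subst coeff_linear_poly_power) simp_all
  ultimately show ?thesis
    using P by (cases "q = 0") (simp_all add: binomial_eq_0 flip: P_def)
qed

lemma p_polynomial_imp_additive:
  fixes f :: "'a::field poly"
  assumes p: "prime CHAR('a)" and f: "p_polynomial CHAR('a) f"
  shows "defect f = 0"
proof -
  obtain c N where f: "f = (\<Sum>i<N. monom (c i) (CHAR('a) ^ i))"
    using f by (auto simp: p_polynomial_def)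
  have "prime CHAR('a poly poly)" using p by (simp add: CHAR_poly)
  then have "(x + y :: 'a poly poly) ^ (CHAR('a) ^ i) = x ^ (CHAR('a) ^ i) + y ^ (CHAR('a) ^ i)" for x y i
    by (rule freshmans_dream') (simp add: CHAR_poly)
  then show ?thesis
    unfolding f defect_eq_0_iff
    by (simp add: subst2_sum subst2_monom smult_add_right sum.distrib)
qed

text \<open>Write an exponent n > 0 that is not a power of p as p^e q with p not dividing q. The
  coefficient of T^(n - p^e) T'^(p^e) in the coboundary is q times the coefficient of T^n in f, and
  q is nonzero in k.\<close>

lemma additive_imp_p_polynomial:
  fixes f :: "'a::field poly"
  assumes p: "prime CHAR('a)" and f: "defect f = 0"
  shows "p_polynomial CHAR('a) f"
proof -
  let ?p = "CHAR('a)"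
  have *: "coeff f n = 0" if n: "n \<notin> range (\<lambda>i. ?p ^ i)" for n
  proof (cases "n = 0")
    case True
    then show ?thesis using f by (simp add: defect_zero_coeff_0)
  next
    case False
    have "\<not> is_unit ?p" using p by auto
    then obtain q where q: "n = ?p ^ multiplicity ?p n * q" "\<not> ?p dvd q"
      using multiplicity_decompose'[OF False, of ?p] by blast
    define e where "e = multiplicity ?p n"
    have ne: "q \<noteq> 1" "q \<noteq> 0" using q n False by (auto intro!: rev_image_eqI)
    have p0: "?p > 0" using p by (simp add: prime_gt_0_nat)
    then have pos: "?p ^ e > 0" by simp
    \<comment> \<open>As q > 1, the remaining exponent \<open>d\<close> is positive, so neither pure
      term of the coboundary contributes.\<close>
    have "?p ^ e < ?p ^ e * q" using ne pos by simp
    then obtain d where d: "?p ^ e * q = ?p ^ e + d" "d > 0"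
      by (metis less_imp_add_positive)
    have "of_nat (?p ^ e * q choose ?p ^ e) * coeff f n = 0"
      using coeff_defect[of f "?p ^ e" d] f d p0 q(1) by (simp add: e_def)
    moreover have "(of_nat (?p ^ e * q choose ?p ^ e) :: 'a) \<noteq> 0"
      unfolding of_nat_choose_char_power[OF p] of_nat_eq_0_iff_char_dvd using q(2) .
    ultimately show ?thesis by simp
  qed
  have inj: "inj (\<lambda>i. ?p ^ i)"
    by (intro injI) (simp add: power_inject_exp[OF prime_gt_1_nat[OF p]])
  have "f = (\<Sum>i<Suc (degree f). monom (coeff f (?p ^ i)) (?p ^ i))"
  proof (rule poly_eqI)
    fix n
    show "coeff f n = coeff (\<Sum>i<Suc (degree f). monom (coeff f (?p ^ i)) (?p ^ i)) n"
    proof (cases "n \<in> range (\<lambda>i. ?p ^ i)")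
      case False
      then have "coeff (\<Sum>i<Suc (degree f). monom (coeff f (?p ^ i)) (?p ^ i)) n = 0"
        unfolding coeff_sum by (intro sum.neutral) auto
      then show ?thesis using *[OF False] by simp
    next
      case True
      then obtain i where i: "n = ?p ^ i" by auto
      have eq: "(?p ^ j = ?p ^ i) = (j = i)" for j using inj by (auto dest: injD)
      \<comment> \<open>An index beyond the degree gives an exponent beyond the degree, so cutting
        the sum at \<open>Suc (degree f)\<close> loses nothing.\<close>
      have "i < ?p ^ i" using prime_gt_1_nat[OF p] by (intro power_gt_expt) simp
      then have "coeff f n = 0" if "\<not> i < Suc (degree f)"
        using that i by (intro coeff_eq_0) simp
      then show ?thesis
        unfolding i by (auto simp: coeff_sum eq)
    qed
  qed
  then show ?thesis
    unfolding p_polynomial_def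
    by (intro exI[of _ "\<lambda>i. coeff f (?p ^ i)"] exI[of _ "Suc (degree f)"])
qed

section \<open>Independent families, dual functionals and symmetric tensors\<close>

lemma lin_indep_family_mono:
  assumes "lin_indep_family J a" "I \<subseteq> J"
  shows "lin_indep_family I a"
proof -
  interpret P: vector_space "smult :: 'a \<Rightarrow> 'a poly \<Rightarrow> 'a poly"
    by (rule vector_space_poly)
  show ?thesis
    using assms P.independent_mono[of "a ` J" "a ` I"] inj_on_subset[of a J I]
    unfolding lin_indep_family_def by blast
qed

lemma lin_indep_family_cong:
  "(\<And>i. i \<in> I \<Longrightarrow> a i = b i) \<Longrightarrow> lin_indep_family I a = lin_indep_family I b"
  by (simp add: lin_indep_family_def cong: inj_on_cong image_cong)

lemma lin_indep_family_reindex: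
  assumes "inj_on h I"
  shows "lin_indep_family I (a \<circ> h) = lin_indep_family (h ` I) a"
  by (simp add: lin_indep_family_def image_comp flip: comp_inj_on_iff[OF assms])

lemma lin_indep_coeffs:
  assumes "finite I" "lin_indep_family I a" "\<And>n. (\<Sum>i\<in>I. c i * coeff (a i) n) = 0" "i \<in> I"
  shows "c i = 0"
proof -
  have "(\<Sum>i\<in>I. smult (c i) (a i)) = 0"
    using assms(3) by (intro poly_eqI) (simp add: coeff_sum)
  then show ?thesis
    using assms(2,4) unfolding lin_indep_family_iff[OF assms(1)] by blast
qed

lemma lin_indep_eq_coeffs:
  assumes "finite I" "lin_indep_family I a"
    "(\<Sum>i\<in>I. smult (c i) (a i)) = (\<Sum>i\<in>I. smult (d i) (a i))" "i \<in> I"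
  shows "c i = d i"
proof -
  have "(\<Sum>i\<in>I. smult (c i - d i) (a i)) = 0"
    using assms(3) by (simp add: smult_diff_left sum_subtractf)
  then have "c i - d i = 0"
    using assms(2,4) unfolding lin_indep_family_iff[OF assms(1)]
    by (auto dest: spec[of _ "\<lambda>i. c i - d i"])
  then show ?thesis by simp
qed

text \<open>The dual functionals on the span extend linearly to k[T]. Up to a common degree bound
  \<open>N\<close> a functional is a weighted sum of coefficients, the weights being its values on
  monomials; in this form it applies directly to coefficient identities in one of two
  variables.\<close>

lemma dual_functionals:
  fixes a :: "nat \<Rightarrow> 'a::field poly"
  assumes fin: "finite I" and ind: "lin_indep_family I a"
  shows "\<exists>w N. \<forall>i\<in>I. \<forall>j\<in>I.
    (\<Sum>n\<le>N. w j n * coeff (a i) n) = (if i = j then 1 else 0 :: 'a)"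
proof -
  interpret vector_space_pair "smult :: 'a \<Rightarrow> 'a poly \<Rightarrow> 'a poly" "(*) :: 'a \<Rightarrow> 'a \<Rightarrow> 'a"
    by (intro vector_space_pair.intro vector_space_poly)
       (unfold_locales, simp_all add: algebra_simps)
  have inj: "inj_on a I" and ind': "\<not> vs1.dependent (a ` I)"
    using ind by (auto simp: lin_indep_family_def)
  have "\<exists>g. Vector_Spaces.linear smult (*) g \<and>
      (\<forall>i\<in>I. g (a i) = (if i = j then 1 else 0 :: 'a))" if "j \<in> I" for j
  proof -
    obtain g where g: "Vector_Spaces.linear smult (*) g"
      "\<forall>x\<in>a ` I. g x = (if x = a j then 1 else 0 :: 'a)"
      using linear_independent_extend[OF ind', of "\<lambda>x. if x = a j then 1 else 0"] by blast
    have "\<forall>i\<in>I. g (a i) = (if i = j then 1 else 0)"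
      using g(2) inj that by (auto dest: inj_onD)
    with g(1) show ?thesis by blast
  qed
  then obtain g where g: "\<And>j. j \<in> I \<Longrightarrow> Vector_Spaces.linear smult (*) (g j)"
    "\<And>i j. i \<in> I \<Longrightarrow> j \<in> I \<Longrightarrow> g j (a i) = (if i = j then 1 else 0 :: 'a)"
    by metis
  define N where "N = Max (degree ` a ` I)"
  have "(\<Sum>n\<le>N. g j (monom 1 n) * coeff (a i) n) = (if i = j then 1 else 0)"
    if i: "i \<in> I" and j: "j \<in> I" for i j
  proof -
    interpret G: Vector_Spaces.linear smult "(*)" "g j" by (rule g(1)[OF j])
    have "degree (a i) \<le> N"
      unfolding N_def using fin i by (intro Max_ge) auto
    then have "a i = (\<Sum>n\<le>N. smult (coeff (a i) n) (monom 1 n))"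
      by (simp add: smult_monom poly_as_sum_of_monoms')
    then have "g j (a i) = (\<Sum>n\<le>N. coeff (a i) n * g j (monom 1 n))"
      by (metis (no_types, lifting) G.sum G.scale sum.cong)
    then show ?thesis
      using g(2)[OF i j] by (simp add: mult.commute)
  qed
  then show ?thesis
    by (intro exI[of _ "\<lambda>j n. g j (monom 1 n)"] exI[of _ N]) blast
qed

text \<open>Apply the functional dual to \<open>a j\<close> in the variable indexed by
  \<open>n\<close>: the left side collapses to \<open>b j\<close>, while the right side becomes a
  combination of the \<open>a i\<close>.\<close>

lemma symmetric_tensor_expansion:
  fixes a b :: "nat \<Rightarrow> 'a::field poly"
  assumes fin: "finite I" and ind: "lin_indep_family I a"
    and sym: "\<And>n n'. (\<Sum>i\<in>I. coeff (a i) n * coeff (b i) n')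
                    = (\<Sum>i\<in>I. coeff (a i) n' * coeff (b i) n)"
  shows "\<exists>s. \<forall>j\<in>I. b j = (\<Sum>i\<in>I. smult (s i j) (a i))"
proof -
  obtain w N where "\<forall>i\<in>I. \<forall>j\<in>I.
      (\<Sum>n\<le>N. w j n * coeff (a i) n) = (if i = j then 1 else 0 :: 'a)"
    using dual_functionals[OF fin ind] by blast
  then have w: "(\<Sum>n\<le>N. w j n * coeff (a i) n) = (if i = j then 1 else 0)"
    if "i \<in> I" "j \<in> I" for i j
    using that by blast
  have "b j = (\<Sum>i\<in>I. smult (\<Sum>n\<le>N. w j n * coeff (b i) n) (a i))" if j: "j \<in> I" for j
  proof (rule poly_eqI)
    fix n'
    have "coeff (b j) n' = (\<Sum>i\<in>I. (if i = j then 1 else 0) * coeff (b i) n')"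
      using fin j by (simp add: if_distrib[of "\<lambda>x. x * _"] cong: if_cong)
    also have "\<dots> = (\<Sum>i\<in>I. \<Sum>n\<le>N. w j n * coeff (a i) n * coeff (b i) n')"
      by (intro sum.cong refl) (simp add: w[OF _ j, symmetric] sum_distrib_right)
    also have "\<dots> = (\<Sum>n\<le>N. w j n * (\<Sum>i\<in>I. coeff (a i) n * coeff (b i) n'))"
      by (subst sum.swap) (simp add: sum_distrib_left mult.assoc)
    also have "\<dots> = (\<Sum>n\<le>N. w j n * (\<Sum>i\<in>I. coeff (a i) n' * coeff (b i) n))"
      by (subst sym) (rule refl)
    also have "\<dots> = (\<Sum>i\<in>I. (\<Sum>n\<le>N. w j n * coeff (b i) n) * coeff (a i) n')"
      unfolding sum_distrib_left sum_distrib_right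
      by (subst sum.swap) (simp add: mult_ac)
    finally show "coeff (b j) n' =
        coeff (\<Sum>i\<in>I. smult (\<Sum>n\<le>N. w j n * coeff (b i) n) (a i)) n'"
      by (simp add: coeff_sum)
  qed
  then show ?thesis
    by (intro exI[of _ "\<lambda>i j. \<Sum>n\<le>N. w j n * coeff (b i) n"]) blast
qed

text \<open>Inserting the expansions into the symmetry makes the tensor with coefficients
  \<open>s i j - s j i\<close> in the \<open>a i\<close> vanish; independence is then used once in
  each variable.\<close>

lemma expansion_symmetric:
  fixes a b :: "nat \<Rightarrow> 'a::field poly"
  assumes fin: "finite I" and ind: "lin_indep_family I a"
    and sym: "\<And>n n'. (\<Sum>i\<in>I. coeff (a i) n * coeff (b i) n')
                    = (\<Sum>i\<in>I. coeff (a i) n' * coeff (b i) n)"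
    and b: "\<And>j. j \<in> I \<Longrightarrow> b j = (\<Sum>i\<in>I. smult (s i j) (a i))"
    and "i \<in> I" "j \<in> I"
  shows "s i j = s j i"
proof -
  have "(\<Sum>k\<in>I. (s k j - s j k) * coeff (a k) n') = 0" if j: "j \<in> I" for n' j
  proof (rule lin_indep_coeffs[OF fin ind _ j])
    fix n
    have "(\<Sum>j\<in>I. \<Sum>k\<in>I. s k j * coeff (a k) n' * coeff (a j) n) =
        (\<Sum>j\<in>I. coeff (a j) n * coeff (b j) n')"
      by (simp add: b coeff_sum sum_distrib_left mult_ac)
    also have "\<dots> = (\<Sum>k\<in>I. coeff (a k) n' * coeff (b k) n)"
      by (rule sym)
    also have "\<dots> = (\<Sum>j\<in>I. \<Sum>k\<in>I. s j k * coeff (a k) n' * coeff (a j) n)"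
      by (subst sum.swap) (simp add: b coeff_sum sum_distrib_left mult_ac)
    finally show "(\<Sum>j\<in>I. (\<Sum>k\<in>I. (s k j - s j k) * coeff (a k) n') * coeff (a j) n) = 0"
      by (simp add: sum_distrib_right left_diff_distrib sum_subtractf)
  qed
  then have "s i j - s j i = 0"
    using assms(5,6) lin_indep_coeffs[OF fin ind, of "\<lambda>k. s k j - s j k" i] by blast
  then show ?thesis by simp
qed

lemma smult_sum_right: "smult c (sum f I) = (\<Sum>i\<in>I. smult c (f i))"
  by (induction I rule: infinite_finite_induct) (simp_all add: smult_add_right)

text \<open>Substituting one expansion into the other writes \<open>a k\<close> in terms of the
  \<open>a i\<close>, and independence permits comparing coefficients. Applied in both orders, this
  yields a two-sided inverse matrix.\<close>

lemma expansions_inverse: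
  fixes a b :: "nat \<Rightarrow> 'a::field poly"
  assumes fin: "finite I" and ind: "lin_indep_family I a"
    and b: "\<And>j. j \<in> I \<Longrightarrow> b j = (\<Sum>i\<in>I. smult (s i j) (a i))"
    and a: "\<And>k. k \<in> I \<Longrightarrow> a k = (\<Sum>j\<in>I. smult (r j k) (b j))"
    and i: "i \<in> I" and k: "k \<in> I"
  shows "(\<Sum>j\<in>I. s i j * r j k) = (if i = k then 1 else 0)"
proof (rule lin_indep_eq_coeffs[OF fin ind _ i])
  have "(\<Sum>i\<in>I. smult (\<Sum>j\<in>I. s i j * r j k) (a i)) =
      (\<Sum>j\<in>I. smult (r j k) (\<Sum>i\<in>I. smult (s i j) (a i)))"
    unfolding smult_sum smult_sum_right by (subst sum.swap) (simp add: mult.commute)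
  also have "\<dots> = a k"
    using a[OF k] b by simp
  also have "\<dots> = (\<Sum>i\<in>I. smult (if i = k then 1 else 0) (a i))"
    using fin k by (simp add: if_distrib[of "\<lambda>x. smult x _"] cong: if_cong)
  finally show "(\<Sum>i\<in>I. smult (\<Sum>j\<in>I. s i j * r j k) (a i)) =
      (\<Sum>i\<in>I. smult (if i = k then 1 else 0) (a i))" .
qed

section \<open>Symmetric forms and their diagonal in characteristic 2\<close>

abbreviation strict_pairs :: "nat \<Rightarrow> (nat \<times> nat) set" where
  "strict_pairs r \<equiv> {(i, j). 1 \<le> i \<and> i < j \<and> j \<le> r}"

text \<open>Grouping mirror terms serves two ends: for symmetric \<open>g\<close> they cancel in
  characteristic 2, leaving the diagonal, and a sum over i < j of mirror pairs becomes a full double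
  sum when the diagonal vanishes.\<close>

lemma sum_square_split:
  fixes g :: "nat \<Rightarrow> nat \<Rightarrow> 'b::comm_monoid_add"
  shows "(\<Sum>i\<in>{1..r}. \<Sum>j\<in>{1..r}. g i j) =
    (\<Sum>i\<in>{1..r}. g i i) + (\<Sum>(i, j)\<in>strict_pairs r. g i j + g j i)"
proof -
  let ?D = "(\<lambda>i. (i, i)) ` {1..r}" and ?U = "strict_pairs r"
  let ?L = "(\<lambda>(i, j). (j, i)) ` ?U"
  have finU: "finite ?U"
    by (rule finite_subset[of _ "{1..r} \<times> {1..r}"]) auto
  have "(\<Sum>i\<in>{1..r}. \<Sum>j\<in>{1..r}. g i j) = (\<Sum>(i, j)\<in>{1..r} \<times> {1..r}. g i j)"
    by (simp add: sum.cartesian_product)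
  also have "{1..r} \<times> {1..r} = ?D \<union> (?U \<union> ?L)"
    by (auto simp: image_iff)
  also have "(\<Sum>(i, j)\<in>?D \<union> (?U \<union> ?L). g i j) =
      (\<Sum>(i, j)\<in>?D. g i j) + ((\<Sum>(i, j)\<in>?U. g i j) + (\<Sum>(i, j)\<in>?L. g i j))"
    using finU by (subst sum.union_disjoint; (subst sum.union_disjoint)?) auto
  also have "(\<Sum>(i, j)\<in>?D. g i j) = (\<Sum>i\<in>{1..r}. g i i)"
    by (subst sum.reindex) (auto simp: inj_on_def)
  also have "(\<Sum>(i, j)\<in>?L. g i j) = (\<Sum>(i, j)\<in>?U. g j i)"
    by (subst sum.reindex) (auto simp: inj_on_def intro!: sum.cong)
  also have "(\<Sum>(i, j)\<in>?U. g i j) + (\<Sum>(i, j)\<in>?U. g j i) = (\<Sum>(i, j)\<in>?U. g i j + g j i)"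
    unfolding sum.distrib[symmetric] by (intro sum.cong) auto
  finally show ?thesis .
qed

lemma char_2_add_self:
  fixes x :: "'a::comm_ring_1"
  assumes "CHAR('a) = 2"
  shows "x + x = 0"
proof -
  have "(2 :: 'a) = 0" using of_nat_CHAR[where 'a = 'a] assms by simp
  then show ?thesis by (metis mult_2 mult_zero_left)
qed

text \<open>
  Over an imperfect field the squares of the \<^term>\<open>a i\<close> may be dependent even though the
  \<^term>\<open>a i\<close> are not, so the hypothesis is used coefficientwise: additivity of squaring turns
  it into the vanishing of the diagonal form on the span of all coefficient vectors, which is
  the whole space.
\<close>

lemma alternating_of_coeffs:
  fixes a :: "nat \<Rightarrow> 'a::field poly"
  assumes two: "CHAR('a) = 2" and ind: "lin_indep_family {1..r} a"
    and sym: "\<And>i j. i \<in> {1..r} \<Longrightarrow> j \<in> {1..r} \<Longrightarrow> s i j = s j i"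
    and iso: "\<And>n. (\<Sum>i\<in>{1..r}. \<Sum>j\<in>{1..r}. s i j * (coeff (a i) n * coeff (a j) n)) = 0"
    and j: "j \<in> {1..r}"
  shows "s j j = 0"
proof -
  obtain w N where "\<forall>i\<in>{1..r}. \<forall>j\<in>{1..r}.
      (\<Sum>n\<le>N. w j n * coeff (a i) n) = (if i = j then 1 else 0 :: 'a)"
    using dual_functionals[OF finite_atLeastAtMost ind] by blast
  then have w: "(\<Sum>n\<le>N. w j n * coeff (a i) n) = (if i = j then 1 else 0)"
    if "i \<in> {1..r}" "j \<in> {1..r}" for i j
    using that by blast
  have off: "(\<Sum>(i, j)\<in>strict_pairs r. s i j * (coeff (a i) n * coeff (a j) n) +
      s j i * (coeff (a j) n * coeff (a i) n)) = 0" for n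
  proof (intro sum.neutral ballI, clarify)
    fix i j
    assume "1 \<le> i" "i < j" "j \<le> r"
    then have "s j i * (coeff (a j) n * coeff (a i) n) = s i j * (coeff (a i) n * coeff (a j) n)"
      using sym[of i j] by (simp add: mult.commute)
    then show "s i j * (coeff (a i) n * coeff (a j) n) + s j i * (coeff (a j) n * coeff (a i) n) = 0"
      by (simp only: char_2_add_self[OF two])
  qed
  have diag: "(\<Sum>i\<in>{1..r}. s i i * (coeff (a i) n)\<^sup>2) = 0" for n
    using iso[of n] unfolding sum_square_split off by (simp add: power2_eq_square)
  \<comment> \<open>The diagonal form is evaluated at the j-th unit vector, which the weights
    \<open>w j\<close> produce from the coefficient vectors.\<close>
  have "s j j = (\<Sum>i\<in>{1..r}. s i i * (if i = j then 1 else 0)\<^sup>2)"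
    using j by (simp add: if_distrib[of "\<lambda>x. x\<^sup>2"] if_distrib[of "\<lambda>x. _ * x"] cong: if_cong)
  also have "\<dots> = (\<Sum>i\<in>{1..r}. s i i * (\<Sum>n\<le>N. w j n * coeff (a i) n)\<^sup>2)"
    by (intro sum.cong refl) (simp add: w[OF _ j])
  also have "\<dots> = (\<Sum>i\<in>{1..r}. s i i * (\<Sum>n\<le>N. (w j n * coeff (a i) n)\<^sup>2))"
    by (subst freshmans_dream_sum) (simp_all add: two)
  also have "\<dots> = (\<Sum>n\<le>N. (w j n)\<^sup>2 * (\<Sum>i\<in>{1..r}. s i i * (coeff (a i) n)\<^sup>2))"
    unfolding sum_distrib_left by (subst sum.swap) (simp add: power_mult_distrib mult_ac)
  also have "\<dots> = 0" by (simp only: diag mult_zero_right sum.neutral_const)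
  finally show ?thesis .
qed

section \<open>Coboundaries that are sums of products a_i(T) b_i(T')\<close>

definition tensor_sum :: "nat set \<Rightarrow> (nat \<Rightarrow> 'a::field poly) \<Rightarrow> (nat \<Rightarrow> 'a poly) \<Rightarrow> 'a poly poly" where
  "tensor_sum I a b = (\<Sum>i\<in>I. subst2 var_T (a i) * subst2 var_T' (b i))"

lemma coeff_tensor_sum:
  "coeff (coeff (tensor_sum I a b) n') n = (\<Sum>i\<in>I. coeff (a i) n * coeff (b i) n')"
  by (simp add: tensor_sum_def coeff_sum coeff_tensor)

text \<open>A coboundary is unchanged when T and T' are exchanged; on coefficients this is the
  symmetry of binomial coefficients.\<close>

lemma coboundary_symmetric:
  assumes "defect f = tensor_sum I a b"
  shows "(\<Sum>i\<in>I. coeff (a i) n * coeff (b i) n') = (\<Sum>i\<in>I. coeff (a i) n' * coeff (b i) n)"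
proof -
  have "coeff (coeff (defect f) n') n = coeff (coeff (defect f) n) n'"
    using binomial_symmetric[of n "n + n'"] by (simp add: coeff_defect add.commute)
  then show ?thesis
    unfolding assms coeff_tensor_sum .
qed

text \<open>By Pascal's rule and symmetry the middle binomial coefficient is twice another one when
  n > 0, so it vanishes in characteristic 2.\<close>

lemma coboundary_diagonal:
  fixes f :: "'a::field poly"
  assumes two: "CHAR('a) = 2" and f: "defect f = tensor_sum I a b"
    and a: "\<And>i. i \<in> I \<Longrightarrow> defect (a i) = 0"
  shows "(\<Sum>i\<in>I. coeff (a i) n * coeff (b i) n) = 0"
proof (cases n)
  \<comment> \<open>Here the binomial coefficient is 1; the sum vanishes because additive
    polynomials have no constant term.\<close>
  case 0
  then show ?thesis using a by (simp add: defect_zero_coeff_0)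
next
  case (Suc m)
  have "(n + n) choose n = ((n + m) choose m) + ((n + m) choose Suc m)"
    using Suc by simp
  also have "(n + m) choose Suc m = (n + m) choose m"
    using binomial_symmetric[of m "n + m"] Suc by simp
  finally have "(of_nat ((n + n) choose n) :: 'a) = 0"
    using char_2_add_self[OF two, of "of_nat ((n + m) choose m)"] by simp
  then have "coeff (coeff (defect f) n) n = 0"
    using Suc by (simp add: coeff_defect)
  then show ?thesis
    unfolding f coeff_tensor_sum .
qed

text \<open>Each product of additive polynomials contributes two mirror tensors. For p = 2 the pairs
  i < j thus cover everything off the diagonal, which is zero by \<open>alt\<close>; otherwise the
  double sum counts every tensor twice and the factor 1/2 corrects this.\<close>

lemma defect_quadratic_part:
  fixes a :: "nat \<Rightarrow> 'a::field poly" and S :: "'a mat"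
  defines "s \<equiv> \<lambda>i j. S $$ (i - 1, j - 1)"
  assumes p: "prime CHAR('a)" and S: "S \<in> carrier_mat r r"
    and a: "\<And>i. i \<in> {1..r} \<Longrightarrow> defect (a i) = 0"
    and sym: "\<And>i j. i \<in> {1..r} \<Longrightarrow> j \<in> {1..r} \<Longrightarrow> s i j = s j i"
    and alt: "\<And>i. CHAR('a) = 2 \<Longrightarrow> i \<in> {1..r} \<Longrightarrow> s i i = 0"
  shows "defect (quadratic_part CHAR('a) r a S) =
    (\<Sum>i\<in>{1..r}. \<Sum>j\<in>{1..r}. smult [:s i j:] (subst2 var_T (a i) * subst2 var_T' (a j)))"
    (is "_ = (\<Sum>i\<in>_. \<Sum>j\<in>_. ?g i j)")
proof -
  \<comment> \<open>Symmetry of \<open>s\<close> lets the second mixed term carry the coefficient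
    \<open>s j i\<close>, as \<open>?g j i\<close> requires.\<close>
  have defect_term: "defect (smult (s i j) (a i * a j)) = ?g i j + ?g j i"
    if "i \<in> {1..r}" "j \<in> {1..r}" for i j
    using that sym by (simp add: defect_smult defect_mult[OF a a] smult_add_right)
  show ?thesis
  proof (cases "CHAR('a) = 2")
    case True
    have "defect (quadratic_part CHAR('a) r a S) =
        (\<Sum>(i, j)\<in>strict_pairs r. defect (smult (s i j) (a i * a j)))"
      by (simp add: quadratic_part_def True defect_sum s_def split_def)
    also have "\<dots> = (\<Sum>(i, j)\<in>strict_pairs r. ?g i j + ?g j i)"
      by (intro sum.cong refl) (auto simp: defect_term)
    also have "\<dots> = (\<Sum>i\<in>{1..r}. \<Sum>j\<in>{1..r}. ?g i j)"
      unfolding sum_square_split using alt[OF True] by simp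
    finally show ?thesis .
  next
    case False
    have "\<not> CHAR('a) dvd 2"
      using False primes_dvd_imp_eq[OF p two_is_prime_nat] by blast
    then have two: "(2 :: 'a) \<noteq> 0"
      using of_nat_eq_0_iff_char_dvd[where 'a = 'a, of 2] by simp
    have "quadratic_part CHAR('a) r a S =
        smult (1 / 2) (\<Sum>i\<in>{1..r}. \<Sum>j\<in>{1..r}. smult (s i j) (a i * a j))"
      using False S
      by (subst sum.swap)
         (simp add: quadratic_part_def row_slice_def const_mat_def scalar_prod_def s_def
           sum.atLeast1_atMost_eq atLeast0LessThan sum_distrib_left mult_ac)
    also have "defect \<dots> = smult [:1 / 2:]
        (\<Sum>i\<in>{1..r}. \<Sum>j\<in>{1..r}. defect (smult (s i j) (a i * a j)))"
      by (simp add: defect_smult defect_sum)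
    also have "(\<Sum>i\<in>{1..r}. \<Sum>j\<in>{1..r}. defect (smult (s i j) (a i * a j))) =
        (\<Sum>i\<in>{1..r}. \<Sum>j\<in>{1..r}. ?g i j + ?g j i)"
      by (intro sum.cong refl) (simp add: defect_term)
    also have "\<dots> = (\<Sum>i\<in>{1..r}. \<Sum>j\<in>{1..r}. ?g i j) + (\<Sum>i\<in>{1..r}. \<Sum>j\<in>{1..r}. ?g i j)"
      unfolding sum.distrib by (subst (2) sum.swap) (rule refl)
    also have "smult [:1 / 2:] (X + X) = X" for X :: "'a poly poly"
    proof -
      have "smult [:1 / 2:] (X + X) = smult ([:1 / 2:] + [:1 / 2:]) X"
        by (simp only: smult_add_left smult_add_right)
      also have "[:1 / 2:] + [:1 / 2:] = (1 :: 'a poly)"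
        using two by (simp add: one_pCons field_simps)
      finally show ?thesis by simp
    qed
    finally show ?thesis .
  qed
qed

text \<open>Expanding \<open>b i\<close> produces the coefficients \<open>s j i\<close>; symmetry
  turns them into \<open>s i j\<close>.\<close>

lemma tensor_sum_expand:
  assumes "\<And>j. j \<in> I \<Longrightarrow> b j = (\<Sum>i\<in>I. smult (s i j) (a i))"
    and "\<And>i j. i \<in> I \<Longrightarrow> j \<in> I \<Longrightarrow> s i j = s j i"
  shows "tensor_sum I a b =
    (\<Sum>i\<in>I. \<Sum>j\<in>I. smult [:s i j:] (subst2 var_T (a i) * subst2 var_T' (a j)))"
  unfolding tensor_sum_def
  by (intro sum.cong refl)
     (simp add: assms(1) subst2_sum subst2_smult sum_distrib_left assms(2) cong: sum.cong)

section \<open>The group law of the matrices \<open>eta\<close> and the exponential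
  condition\<close>

definition eta_entry :: "nat \<Rightarrow> (nat \<Rightarrow> 'b::comm_ring_1) \<Rightarrow> nat \<Rightarrow> nat \<Rightarrow> 'b" where
  "eta_entry m u i j =
     (if i = j then 1
      else if i = 0 then (if j = m + 1 then u (2 * m + 1) else u j)
      else if j = m + 1 then u (m + i)
      else 0)"

text \<open>Separates the entry formula from the ring: the same formula describes A over k[T], its
  substitutions over k[T,T'] and its value at 0 over k.\<close>

lemma eta_conv_entry: "eta m a = mat (m + 2) (m + 2) (\<lambda>(i, j). eta_entry m a i j)"
  unfolding eta_def eta_entry_def ..

text \<open>Each index from 1 to 2m + 1 occupies exactly one position: the first row up to m, the
  last column up to 2m, the corner for 2m + 1.\<close>

lemma eta_entry_eq_iff:
  "(\<forall>i<m + 2. \<forall>j<m + 2. eta_entry m u i j = eta_entry m v i j) \<longleftrightarrow>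
   (\<forall>k\<in>{1..2 * m + 1}. u k = v k)"
proof safe
  fix k
  assume eq: "\<forall>i<m + 2. \<forall>j<m + 2. eta_entry m u i j = eta_entry m v i j"
    and k: "k \<in> {1..2 * m + 1}"
  consider "k \<le> m" | "m < k" "k \<le> 2 * m" | "k = 2 * m + 1"
    using k by fastforce
  then show "u k = v k"
  proof cases
    case 1
    then show ?thesis using eq[rule_format, of 0 k] k by (simp add: eta_entry_def)
  next
    case 2
    then have "k - m \<noteq> 0" "k - m \<noteq> m + 1" "k - m < m + 2" "m + (k - m) = k" by auto
    then show ?thesis using eq[rule_format, of "k - m" "m + 1"] by (simp add: eta_entry_def)
  next
    case 3
    then show ?thesis using eq[rule_format, of 0 "m + 1"] k by (simp add: eta_entry_def)
  qed
next
  fix i j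
  assume eq: "\<forall>k\<in>{1..2 * m + 1}. u k = v k" and ij: "i < m + 2" "j < m + 2"
  have "u k = v k" if "1 \<le> k" "k \<le> 2 * m + 1" for k using eq that by simp
  then show "eta_entry m u i j = eta_entry m v i j"
    using ij by (simp add: eta_entry_def)
qed

text \<open>A Heisenberg-type group law: the middle block is the identity, so parameters add and
  only the corner, where first row meets last column, gains products.\<close>

lemma eta_entry_matrix_mult:
  assumes i: "i < m + 2" and j: "j < m + 2"
  shows "(\<Sum>k<m + 2. eta_entry m u i k * eta_entry m v k j) =
    eta_entry m (\<lambda>k. u k + v k + (if k = 2 * m + 1 then \<Sum>k\<in>{1..m}. u k * v (m + k) else 0)) i j"
proof -
  \<comment> \<open>The inner indices 0 and m + 1 are split off, because the first row and the last
    column have their own shape.\<close>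
  have split: "(\<Sum>k<m + 2. f k) = f 0 + (\<Sum>k\<in>{1..m}. f k) + f (m + 1)" for f :: "nat \<Rightarrow> 'a"
    using sum.lessThan_Suc_shift[of f m] by (simp add: sum.atLeast1_atMost_eq)
  consider "i = 0" "j = 0" | "i = 0" "j \<in> {1..m}" | "i = 0" "j = m + 1"
    | "i \<in> {1..m}" | "i = m + 1"
    using i j by fastforce
  then show ?thesis
  proof cases
    case 1
    then show ?thesis unfolding split by (simp add: eta_entry_def)
  next
    case 2
    have "(\<Sum>k\<in>{1..m}. eta_entry m u i k * eta_entry m v k j) =
        (\<Sum>k\<in>{1..m}. if k = j then u j else 0)"
      using 2 by (intro sum.cong) (auto simp: eta_entry_def)
    then show ?thesis using 2 unfolding split by (simp add: eta_entry_def)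
  next
    case 3
    have "(\<Sum>k\<in>{1..m}. eta_entry m u i k * eta_entry m v k j) =
        (\<Sum>k\<in>{1..m}. u k * v (m + k))"
      using 3 by (intro sum.cong) (auto simp: eta_entry_def)
    then show ?thesis using 3 unfolding split by (simp add: eta_entry_def)
  next
    case 4
    have "(\<Sum>k\<in>{1..m}. eta_entry m u i k * eta_entry m v k j) =
        (\<Sum>k\<in>{1..m}. if k = i then eta_entry m v i j else 0)"
      using 4 by (intro sum.cong) (auto simp: eta_entry_def)
    then show ?thesis using 4 unfolding split by (simp add: eta_entry_def)
  next
    case 5
    have "(\<Sum>k\<in>{1..m}. eta_entry m u i k * eta_entry m v k j) = 0"
      using 5 by (intro sum.neutral) (auto simp: eta_entry_def)
    then show ?thesis using 5 j unfolding split by (simp add: eta_entry_def)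
  qed
qed

lemma mat_eq_iff_entries:
  "mat n n (\<lambda>(i, j). f i j) = mat n n (\<lambda>(i, j). g i j) \<longleftrightarrow> (\<forall>i<n. \<forall>j<n. f i j = g i j)"
  by (auto simp: mat_eq_iff)

text \<open>Both sides of the product rule have the shape of \<open>eta\<close>, so the group law
  becomes a condition on the coboundary of each parameter, with a correction only at the
  corner.\<close>

lemma exponential_eta_iff:
  "exponential_matrix (m + 2) (eta m a) \<longleftrightarrow>
    (\<forall>i\<in>{1..2 * m}. defect (a i) = 0) \<and>
    defect (a (2 * m + 1)) = tensor_sum {1..m} a (\<lambda>i. a (m + i))"
    (is "_ \<longleftrightarrow> ?additive \<and> ?cocycle")
proof -
  let ?n = "m + 2"
  let ?E = "\<lambda>u. mat ?n ?n (\<lambda>(i, j). eta_entry m u i j)"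
  let ?w = "\<lambda>(u :: nat \<Rightarrow> 'a poly poly) v k. u k + v k +
    (if k = 2 * m + 1 then \<Sum>k\<in>{1..m}. u k * v (m + k) else 0)"
  \<comment> \<open>Preserving 0 and 1 is all that the shape of \<open>eta\<close> asks of
    \<open>h\<close>; this covers evaluation at 0 and the three substitutions.\<close>
  have map: "map_mat h (eta m a) = ?E (\<lambda>k. h (a k))" if "h 0 = 0" "h 1 = 1"
    for h :: "'a poly \<Rightarrow> 'b::comm_ring_1"
    using that by (intro eq_matI) (auto simp: eta_conv_entry eta_entry_def)
  have one: "1\<^sub>m ?n = ?E (\<lambda>k. 0 :: 'a)"
    by (intro eq_matI) (auto simp: eta_entry_def)
  have at_0: "map_mat (\<lambda>f. poly f 0) (eta m a) = 1\<^sub>m ?n \<longleftrightarrow> (\<forall>k\<in>{1..2 * m + 1}. poly (a k) 0 = 0)"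
    by (subst map) (simp_all only: one mat_eq_iff_entries eta_entry_eq_iff poly_0 poly_1)
  have mult: "?E u * ?E v = ?E (?w u v)" for u v :: "nat \<Rightarrow> 'a poly poly"
  proof (rule eq_matI)
    fix i j
    assume "i < dim_row (?E (?w u v))" "j < dim_col (?E (?w u v))"
    then have ij: "i < ?n" "j < ?n" by simp_all
    then have "(?E u * ?E v) $$ (i, j) = (\<Sum>k<?n. eta_entry m u i k * eta_entry m v k j)"
      by (simp add: scalar_prod_def atLeast0LessThan del: sum.lessThan_Suc)
    also have "\<dots> = ?E (?w u v) $$ (i, j)"
      using ij by (simp only: eta_entry_matrix_mult index_mat prod.case)
    finally show "(?E u * ?E v) $$ (i, j) = ?E (?w u v) $$ (i, j)" .
  qed simp_all
  have "map_mat (subst2 var_T) (eta m a) * map_mat (subst2 var_T') (eta m a) =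
      map_mat (subst2 (var_T + var_T')) (eta m a) \<longleftrightarrow>
    (\<forall>k\<in>{1..2 * m + 1}. subst2 var_T (a k) + subst2 var_T' (a k) +
      (if k = 2 * m + 1 then tensor_sum {1..m} a (\<lambda>i. a (m + i)) else 0) =
      subst2 (var_T + var_T') (a k))"
    by (simp only: map[OF subst2_0 subst2_1] mult mat_eq_iff_entries eta_entry_eq_iff
        tensor_sum_def)
  also have "\<dots> \<longleftrightarrow> (\<forall>k\<in>{1..2 * m + 1}. defect (a k) =
      (if k = 2 * m + 1 then tensor_sum {1..m} a (\<lambda>i. a (m + i)) else 0))"
    by (intro ball_cong refl) (auto simp: defect_def algebra_simps)
  also have "\<dots> \<longleftrightarrow> ?additive \<and> ?cocycle"
    by (auto simp: atLeastAtMostSuc_conv)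
  finally have product: "map_mat (subst2 var_T) (eta m a) * map_mat (subst2 var_T') (eta m a) =
      map_mat (subst2 (var_T + var_T')) (eta m a) \<longleftrightarrow> ?additive \<and> ?cocycle" .
  \<comment> \<open>A(0) = I follows from the product rule: additive polynomials have no constant
    term, and the constant coefficient of the corner's coboundary is minus the constant term of the
    corner.\<close>
  have "poly (a k) 0 = 0" if ?additive ?cocycle "k \<in> {1..2 * m + 1}" for k
  proof (cases "k = 2 * m + 1")
    case False
    then show ?thesis using that by (simp add: poly_0_coeff_0 defect_zero_coeff_0)
  next
    case True
    have "coeff (a i) 0 = 0" if "i \<in> {1..m}" for i
      using \<open>?additive\<close> that by (intro defect_zero_coeff_0) simp
    then have "coeff (coeff (defect (a k)) 0) 0 = 0"
      using \<open>?cocycle\<close> True by (simp add: coeff_tensor_sum)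
    then show ?thesis by (simp add: coeff_defect poly_0_coeff_0)
  qed
  then show ?thesis
    unfolding exponential_matrix_def at_0 product by (auto simp: eta_def)
qed

section \<open>The symmetric matrix S connecting the two families\<close>

lemma row_slice_eq_iff:
  assumes "S \<in> carrier_mat r r"
  shows "row_slice m r a = row_slice 0 r a * const_mat S \<longleftrightarrow>
    (\<forall>j\<in>{1..r}. a (m + j) = (\<Sum>i\<in>{1..r}. smult (S $$ (i - 1, j - 1)) (a i)))"
proof -
  have entry: "(row_slice 0 r a * const_mat S) $$ (0, j) =
      (\<Sum>i\<in>{1..r}. smult (S $$ (i - 1, j)) (a i))" if "j < r" for j
    using assms that
    by (simp add: row_slice_def const_mat_def scalar_prod_def sum.atLeast1_atMost_eq
        atLeast0LessThan)
  have shift: "(\<forall>j<r. P (Suc j)) \<longleftrightarrow> (\<forall>j\<in>{1..r}. P j)" for P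
    by (auto simp: Suc_le_eq gr0_conv_Suc)
  have "row_slice m r a = row_slice 0 r a * const_mat S \<longleftrightarrow>
      (\<forall>j<r. row_slice m r a $$ (0, j) = (row_slice 0 r a * const_mat S) $$ (0, j))"
    using assms by (auto simp: mat_eq_iff row_slice_def const_mat_def)
  also have "\<dots> \<longleftrightarrow> (\<forall>j<r. a (m + Suc j) =
      (\<Sum>i\<in>{1..r}. smult (S $$ (i - 1, Suc j - 1)) (a i)))"
    by (simp add: entry) (simp add: row_slice_def)
  also have "\<dots> \<longleftrightarrow> (\<forall>j\<in>{1..r}. a (m + j) =
      (\<Sum>i\<in>{1..r}. smult (S $$ (i - 1, j - 1)) (a i)))"
    by (rule shift)
  finally show ?thesis .
qed

text \<open>Passes to the indexing from 1 of the polynomial families, so that the results on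
  coefficient functions apply with \<open>s i j = S $$ (i - 1, j - 1)\<close>.\<close>

lemma connecting_matrix_iff:
  "connecting_matrix m r a S \<longleftrightarrow>
    S \<in> carrier_mat r r \<and> invertible_mat S \<and>
    (\<forall>i\<in>{1..r}. \<forall>j\<in>{1..r}. S $$ (i - 1, j - 1) = S $$ (j - 1, i - 1)) \<and>
    (\<forall>j\<in>{1..r}. a (m + j) = (\<Sum>i\<in>{1..r}. smult (S $$ (i - 1, j - 1)) (a i)))"
proof -
  have "symmetric_mat S \<longleftrightarrow>
      (\<forall>i\<in>{1..r}. \<forall>j\<in>{1..r}. S $$ (i - 1, j - 1) = S $$ (j - 1, i - 1))"
    if "S \<in> carrier_mat r r"
  proof -
    have "symmetric_mat S \<longleftrightarrow> (\<forall>i<r. \<forall>j<r. S $$ (i, j) = S $$ (j, i))"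
      using that by (auto simp: symmetric_mat_def mat_eq_iff)
    also have "\<dots> \<longleftrightarrow> (\<forall>i\<in>Suc ` {..<r}. \<forall>j\<in>Suc ` {..<r}. S $$ (i - 1, j - 1) = S $$ (j - 1, i - 1))"
      by auto
    finally show ?thesis by (simp only: image_Suc_lessThan One_nat_def)
  qed
  then show ?thesis
    unfolding connecting_matrix_def general_linear_def using row_slice_eq_iff[of S r m a] by auto
qed

text \<open>The columns of S are coordinates with respect to an independent family.\<close>

lemma connecting_matrix_unique:
  assumes "lin_indep_family {1..r} a" "connecting_matrix m r a S" "connecting_matrix m r a S'"
  shows "S' = S"
proof (rule eq_matI)
  have dim: "S \<in> carrier_mat r r" "S' \<in> carrier_mat r r"
    using assms(2,3) by (simp_all add: connecting_matrix_iff)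
  then show "dim_row S' = dim_row S" "dim_col S' = dim_col S" by auto
  fix i j
  assume "i < dim_row S" "j < dim_col S"
  then have ij: "Suc i \<in> {1..r}" "Suc j \<in> {1..r}" using dim by auto
  have expand: "a (m + Suc j) = (\<Sum>i\<in>{1..r}. smult (M $$ (i - 1, Suc j - 1)) (a i))"
    if "connecting_matrix m r a M" for M
    using that ij(2) unfolding connecting_matrix_iff by blast
  from lin_indep_eq_coeffs[OF _ assms(1)
    trans[OF sym[OF expand[OF assms(3)]] expand[OF assms(2)]] ij(1)]
  show "S' $$ (i, j) = S $$ (i, j)" by simp
qed

text \<open>The symmetry of the coboundary persists when the two families are exchanged. Each
  independent family therefore expands the other, and the two coefficient matrices are mutually
  inverse.\<close>

lemma ex_connecting_matrix:
  fixes a :: "nat \<Rightarrow> 'a::field poly"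
  assumes a: "lin_indep_family {1..r} a" and b: "lin_indep_family {1..r} (\<lambda>i. a (m + i))"
    and f: "defect f = tensor_sum {1..r} a (\<lambda>i. a (m + i))"
  shows "\<exists>S. connecting_matrix m r a S"
proof -
  let ?I = "{1..r}" and ?b = "\<lambda>i. a (m + i)"
  have sym: "(\<Sum>i\<in>?I. coeff (a i) n * coeff (?b i) n') =
      (\<Sum>i\<in>?I. coeff (a i) n' * coeff (?b i) n)" for n n'
    by (rule coboundary_symmetric[OF f])
  have sym': "(\<Sum>i\<in>?I. coeff (?b i) n * coeff (a i) n') =
      (\<Sum>i\<in>?I. coeff (?b i) n' * coeff (a i) n)" for n n'
    using sym[of n' n] by (simp add: mult.commute)
  obtain s where "\<forall>j\<in>?I. ?b j = (\<Sum>i\<in>?I. smult (s i j) (a i))"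
    using symmetric_tensor_expansion[OF finite_atLeastAtMost a sym] by blast
  then have s: "?b j = (\<Sum>i\<in>?I. smult (s i j) (a i))" if "j \<in> ?I" for j
    using that by blast
  obtain t where "\<forall>j\<in>?I. a j = (\<Sum>i\<in>?I. smult (t i j) (?b i))"
    using symmetric_tensor_expansion[OF finite_atLeastAtMost b sym'] by blast
  then have t: "a j = (\<Sum>i\<in>?I. smult (t i j) (?b i))" if "j \<in> ?I" for j
    using that by blast
  define S where "S = mat r r (\<lambda>(i, j). s (Suc i) (Suc j))"
  define T where "T = mat r r (\<lambda>(i, j). t (Suc i) (Suc j))"
  have st: "(\<Sum>j\<in>?I. s i j * t j k) = (if i = k then 1 else 0)"
    if "i \<in> ?I" "k \<in> ?I" for i k
    by (rule expansions_inverse[OF finite_atLeastAtMost a s t that])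
  have ts: "(\<Sum>j\<in>?I. t i j * s j k) = (if i = k then 1 else 0)"
    if "i \<in> ?I" "k \<in> ?I" for i k
    by (rule expansions_inverse[OF finite_atLeastAtMost b t s that])
  have "S * T = 1\<^sub>m r"
    using st by (intro eq_matI)
      (auto simp: S_def T_def scalar_prod_def sum.atLeast1_atMost_eq atLeast0LessThan)
  moreover have "T * S = 1\<^sub>m r"
    using ts by (intro eq_matI)
      (auto simp: S_def T_def scalar_prod_def sum.atLeast1_atMost_eq atLeast0LessThan)
  ultimately have "invertible_mat S"
    unfolding invertible_mat_def inverts_mat_def
    by (intro conjI exI[of _ T]) (simp_all add: S_def T_def)
  moreover have entry: "S $$ (i - 1, j - 1) = s i j" if "i \<in> ?I" "j \<in> ?I" for i j
    using that by (cases i; cases j) (auto simp: S_def)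
  moreover have "s i j = s j i" if "i \<in> ?I" "j \<in> ?I" for i j
    by (rule expansion_symmetric[OF finite_atLeastAtMost a sym s that])
  moreover have "?b j = (\<Sum>i\<in>?I. smult (S $$ (i - 1, j - 1)) (a i))" if "j \<in> ?I" for j
    using that s by (simp only: entry cong: sum.cong)
  ultimately have "connecting_matrix m r a S"
    unfolding connecting_matrix_iff by (simp add: S_def)
  then show ?thesis ..
qed

section \<open>Membership in \<open>frakH\<close> and the characterization of its exponential
  matrices\<close>

lemma frakH_etaD:
  assumes H: "eta m a \<in> frakH m l r1 r2" and O: "(l, r1, r2) \<in> Omega m"
  shows "lin_indep_family {1..r1} a" "lin_indep_family {1..r1} (\<lambda>i. a (m + i))"
    "\<And>i. i \<in> {1..m} - {1..r1} \<Longrightarrow> a i = 0 \<or> a (m + i) = 0"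
proof -
  \<comment> \<open>Membership provides some family \<open>a'\<close> representing the same matrix;
    equality of entries transfers its properties to \<open>a\<close>.\<close>
  obtain a' where a': "eta m a = eta m a'" "lin_indep_family {1..l} a'"
    "lin_indep_family ({m + 1..m + r1} \<union> {m + l + 1..m + l + r2}) a'"
    "\<forall>i \<in> {l + 1..m} \<union> {m + r1 + 1..m + l} \<union> {m + l + r2 + 1..2 * m}. a' i = 0"
    using H unfolding frakH_def by blast
  have O': "l \<le> m" "r1 \<le> l" using O by (auto simp: Omega_def)
  have "\<forall>k\<in>{1..2 * m + 1}. a k = a' k"
    using a'(1) unfolding eta_conv_entry mat_eq_iff_entries eta_entry_eq_iff .
  then have eq: "a k = a' k" if "1 \<le> k" "k \<le> 2 * m" for k
    using that by simp
  have "lin_indep_family {1..r1} a'"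
    using a'(2) by (rule lin_indep_family_mono) (use O' in auto)
  moreover have "lin_indep_family {1..r1} a = lin_indep_family {1..r1} a'"
    by (rule lin_indep_family_cong) (use O' eq in auto)
  ultimately show "lin_indep_family {1..r1} a" by simp
  have "lin_indep_family ((+) m ` {1..r1}) a'"
    using a'(3) by (rule lin_indep_family_mono) auto
  then have "lin_indep_family {1..r1} (a' \<circ> (+) m)"
    by (simp add: lin_indep_family_reindex)
  moreover have "lin_indep_family {1..r1} (\<lambda>i. a (m + i)) = lin_indep_family {1..r1} (a' \<circ> (+) m)"
    by (rule lin_indep_family_cong) (use O' eq in auto)
  ultimately show "lin_indep_family {1..r1} (\<lambda>i. a (m + i))" by simp
  fix i
  assume "i \<in> {1..m} - {1..r1}"
  \<comment> \<open>For r1 < i <= l the factor \<open>a (m + i)\<close> vanishes, for l < i <= m the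
    factor \<open>a i\<close>.\<close>
  then show "a i = 0 \<or> a (m + i) = 0"
    using a'(4) O' eq[of i] eq[of "m + i"] by (cases "i \<le> l") auto
qed

theorem theorem3p3:
  fixes a :: "nat \<Rightarrow> 'a::field poly" and p m l r1 r2 :: nat
  assumes "CHAR('a) = p" and "p > 0"
    and "m \<ge> 1"
    and "(l, r1, r2) \<in> Omega m"
    and "eta m a \<in> frakH m l r1 r2"
  shows "exponential_matrix (m + 2) (eta m a) \<longleftrightarrow>
    (\<forall>i\<in>{1..2 * m}. p_polynomial p (a i)) \<and>
    (\<exists>S. (connecting_matrix m r1 a S \<and> (\<forall>S'. connecting_matrix m r1 a S' \<longrightarrow> S' = S)) \<and>
         (p = 2 \<longrightarrow> (\<forall>i<r1. S $$ (i, i) = 0)) \<and>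
         (\<exists>!\<alpha>. p_polynomial p \<alpha> \<and> a (2 * m + 1) = \<alpha> + quadratic_part p r1 a S))"
proof -
  let ?I = "{1..r1}" and ?b = "\<lambda>i. a (m + i)" and ?f = "a (2 * m + 1)"
  have p: "prime p" "prime CHAR('a)"
    using assms(1,2) prime_CHAR_semidom[where 'a = 'a] by simp_all
  have r1: "r1 \<le> m" using assms(4) by (auto simp: Omega_def)
  note a = frakH_etaD(1)[OF assms(5,4)] and b = frakH_etaD(2)[OF assms(5,4)]
    and zero = frakH_etaD(3)[OF assms(5,4)]
  have additive_iff: "p_polynomial p g \<longleftrightarrow> defect g = 0" for g :: "'a poly"
    using p_polynomial_imp_additive[OF p(2)] additive_imp_p_polynomial[OF p(2)] assms(1) by blast
  have tensor: "tensor_sum {1..m} a ?b = tensor_sum ?I a ?b"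
    unfolding tensor_sum_def
  proof (rule sum.mono_neutral_right)
    show "\<forall>i\<in>{1..m} - ?I. subst2 var_T (a i) * subst2 var_T' (?b i) = 0"
    proof
      fix i
      assume "i \<in> {1..m} - ?I"
      from zero[OF this] show "subst2 var_T (a i) * subst2 var_T' (?b i) = 0" by auto
    qed
  qed (use r1 in auto)
  \<comment> \<open>The quadratic part has the tensor as its coboundary, so \<open>?f\<close> has
    the same coboundary iff the difference is additive.\<close>
  have cocycle_iff: "defect ?f = tensor_sum ?I a ?b \<longleftrightarrow>
      p_polynomial p (?f - quadratic_part p r1 a S)"
    if add: "\<forall>i\<in>{1..2 * m}. defect (a i) = 0" and S: "connecting_matrix m r1 a S"
      and alt: "p = 2 \<longrightarrow> (\<forall>i<r1. S $$ (i, i) = 0)" for S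
  proof -
    have S': "S \<in> carrier_mat r1 r1"
      "\<And>i j. i \<in> ?I \<Longrightarrow> j \<in> ?I \<Longrightarrow> S $$ (i - 1, j - 1) = S $$ (j - 1, i - 1)"
      "\<And>j. j \<in> ?I \<Longrightarrow> ?b j = (\<Sum>i\<in>?I. smult (S $$ (i - 1, j - 1)) (a i))"
      using S unfolding connecting_matrix_iff by blast+
    have expand: "tensor_sum ?I a ?b = (\<Sum>i\<in>?I. \<Sum>j\<in>?I.
        smult [:S $$ (i - 1, j - 1):] (subst2 var_T (a i) * subst2 var_T' (a j)))"
      by (rule tensor_sum_expand) (use S'(2,3) in blast)+
    have "defect (quadratic_part CHAR('a) r1 a S) = tensor_sum ?I a ?b"
      unfolding expand
    proof (rule defect_quadratic_part[OF p(2) S'(1)])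
      show "defect (a i) = 0" if "i \<in> ?I" for i using add that r1 by simp
      show "S $$ (i - 1, i - 1) = 0" if "CHAR('a) = 2" "i \<in> ?I" for i
        using alt that assms(1) by (cases i) auto
    qed (use S'(2) in blast)
    moreover have "defect ?f = defect (?f - quadratic_part p r1 a S) + defect (quadratic_part p r1 a S)"
      by (simp flip: defect_add)
    ultimately show ?thesis
      unfolding additive_iff assms(1) by simp
  qed
  \<comment> \<open>The equation forces the value of alpha, so unique existence says that this value
    is a p-polynomial.\<close>
  have unique_iff: "(\<exists>!\<alpha>. p_polynomial p \<alpha> \<and> ?f = \<alpha> + quadratic_part p r1 a S) \<longleftrightarrow>
      p_polynomial p (?f - quadratic_part p r1 a S)" for S
  proof -
    have "p_polynomial p \<alpha> \<and> ?f = \<alpha> + quadratic_part p r1 a S \<longleftrightarrow>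
        \<alpha> = ?f - quadratic_part p r1 a S \<and> p_polynomial p (?f - quadratic_part p r1 a S)" for \<alpha>
      by auto
    then show ?thesis by auto
  qed
  have alternating: "S $$ (i, i) = 0"
    if add: "\<forall>i\<in>{1..2 * m}. defect (a i) = 0" and f: "defect ?f = tensor_sum ?I a ?b"
      and S: "connecting_matrix m r1 a S" and two: "p = 2" and i: "i < r1" for S i
  proof -
    let ?s = "\<lambda>i j. S $$ (i - 1, j - 1)"
    have "(\<Sum>i\<in>?I. \<Sum>j\<in>?I. ?s i j * (coeff (a i) n * coeff (a j) n)) = 0" for n
    proof -
      \<comment> \<open>Expanding \<open>?b j\<close> identifies the form at the n-th coefficient
        vector with the coefficient of T^n T'^n in the coboundary.\<close>
      have "(\<Sum>i\<in>?I. \<Sum>j\<in>?I. ?s i j * (coeff (a i) n * coeff (a j) n)) =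
          (\<Sum>j\<in>?I. coeff (a j) n * coeff (?b j) n)"
        using S unfolding connecting_matrix_iff
        by (subst sum.swap) (simp add: coeff_sum sum_distrib_left mult_ac)
      also have "\<dots> = 0"
        by (rule coboundary_diagonal[OF _ f]) (use assms(1) two add r1 in auto)
      finally show ?thesis .
    qed
    then have "?s (Suc i) (Suc i) = 0"
      using S i assms(1) two unfolding connecting_matrix_iff
      by (intro alternating_of_coeffs[OF _ a, where s = ?s]) auto
    then show ?thesis by simp
  qed
  have connecting_iff: "defect ?f = tensor_sum ?I a ?b \<longleftrightarrow>
      (\<exists>S. (connecting_matrix m r1 a S \<and> (\<forall>S'. connecting_matrix m r1 a S' \<longrightarrow> S' = S)) \<and>
           (p = 2 \<longrightarrow> (\<forall>i<r1. S $$ (i, i) = 0)) \<and>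
           p_polynomial p (?f - quadratic_part p r1 a S))" (is "?cocycle \<longleftrightarrow> ?S")
    if add: "\<forall>i\<in>{1..2 * m}. defect (a i) = 0"
  proof
    assume f: ?cocycle
    then obtain S where S: "connecting_matrix m r1 a S"
      using ex_connecting_matrix[OF a b] by blast
    have alt: "p = 2 \<longrightarrow> (\<forall>i<r1. S $$ (i, i) = 0)"
      using alternating[OF add f S] by blast
    show ?S
      using S alt connecting_matrix_unique[OF a S] cocycle_iff[OF add S alt] f by blast
  next
    assume ?S
    then show ?cocycle using cocycle_iff[OF add] by blast
  qed
  have "(\<forall>i\<in>{1..2 * m}. p_polynomial p (a i)) \<longleftrightarrow> (\<forall>i\<in>{1..2 * m}. defect (a i) = 0)"
    by (simp only: additive_iff)
  then show ?thesis
    unfolding exponential_eta_iff tensor unique_iff using connecting_iff by blast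
qed

end
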